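(* Let $(X,d,E)$ and $(Y,\rho,F)$ be vector metric spaces, and let $f$ and $g$ be vectorial continuous functions from $X$ to $Y$. Then the set $\{x\in X:f(x)=g(x)\}$ is an $E$-closed subset of $X$.
   Context: In a Riesz space $E$, $a_n\downarrow 0$ means $(a_n)$ is a decreasing sequence in $E$ with $\inf_n a_n=0$. A vector metric ($E$-metric) on a non-empty set $X$, with $E$ a Riesz space, is a map $d:X\times X\to E$ such that (vm1) $d(x,y)=0$ if and only if $x=y$; (vm2) $d(x,y)\le d(x,z)+d(y,z)$ for all $x,y,z\in X$. The triple $(X,d,E)$ is a vector metric space. A sequence $(x_n)$ in $X$ is $E$-convergent to $x\in X$, written $x_n\xrightarrow{d,E}x$, if there is a sequence $(a_n)$ in $E$ with $a_n\downarrow 0$ and $d(x_n,x)\le a_n$ for all $n$. A subset $U\subseteq X$ is $E$-closed if $(x_n)\subseteq U$ and $x_n\xrightarrow{d,E}x$ imply $x\in U$. A function $f:(X,d,E)\to(Y,\rho,F)$ is vectorial continuous if, for every $x\in X$, $x_n\xrightarrow{d,E}x$ implies $f(x_n)\xrightarrow{\rho,F}f(x)$. *)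

theory Defs
  imports Complex_Main "HOL-Library.Lub_Glb"
begin

class riesz_space = ordered_real_vector + lattice

definition decreases_to_zero :: "(nat \<Rightarrow> 'e::riesz_space) \<Rightarrow> bool" where
  "decreases_to_zero a \<longleftrightarrow> decseq a \<and> isGlb UNIV (range a) 0"

(* The values of d outside the carrier X are irrelevant. *)
locale vector_metric_space =
  fixes X :: "'x set" and d :: "'x \<Rightarrow> 'x \<Rightarrow> 'e::riesz_space"
  assumes nonempty: "X \<noteq> {}"
    and vm1: "\<lbrakk>x \<in> X; y \<in> X\<rbrakk> \<Longrightarrow> d x y = 0 \<longleftrightarrow> x = y"
    and vm2: "\<lbrakk>x \<in> X; y \<in> X; z \<in> X\<rbrakk> \<Longrightarrow> d x y \<le> d x z + d y z"

definition E_convergent ::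
  "'x set \<Rightarrow> ('x \<Rightarrow> 'x \<Rightarrow> 'e::riesz_space) \<Rightarrow> (nat \<Rightarrow> 'x) \<Rightarrow> 'x \<Rightarrow> bool" where
  "E_convergent X d s x \<longleftrightarrow> range s \<subseteq> X \<and> x \<in> X \<and>
     (\<exists>a. decreases_to_zero a \<and> (\<forall>n. d (s n) x \<le> a n))"

definition E_closed ::
  "'x set \<Rightarrow> ('x \<Rightarrow> 'x \<Rightarrow> 'e::riesz_space) \<Rightarrow> 'x set \<Rightarrow> bool" where
  "E_closed X d U \<longleftrightarrow> U \<subseteq> X \<and>
     (\<forall>s x. range s \<subseteq> U \<and> E_convergent X d s x \<longrightarrow> x \<in> U)"

definition vectorial_continuous ::
  "'x set \<Rightarrow> ('x \<Rightarrow> 'x \<Rightarrow> 'e::riesz_space) \<Rightarrow>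
   'y set \<Rightarrow> ('y \<Rightarrow> 'y \<Rightarrow> 'f::riesz_space) \<Rightarrow> ('x \<Rightarrow> 'y) \<Rightarrow> bool" where
  "vectorial_continuous X d Y \<rho> f \<longleftrightarrow> f ` X \<subseteq> Y \<and>
     (\<forall>x\<in>X. \<forall>s. E_convergent X d s x \<longrightarrow> E_convergent Y \<rho> (\<lambda>n. f (s n)) (f x))"

end

theory Submission
  imports Defs
begin

text \<open>Limits are unique in a vector metric space: two limits of one sequence are at distance at most
  \<open>a n + b n\<close>, where both sequences decrease to zero. A sequence on which \<open>f\<close> and \<open>g\<close> agree
  therefore forces them to agree at its limit.\<close>

lemma decreases_to_zero_lower_bound:
  assumes "decreases_to_zero a" and "\<And>n. z \<le> a n"
  shows "z \<le> 0"
proof -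
  have "isGlb UNIV (range a) 0"
    using assms(1) by (simp add: decreases_to_zero_def)
  moreover have "isLb UNIV (range a) z"
    using assms(2) by (auto intro: isLbI setgeI)
  ultimately show ?thesis
    by (rule isGlb_le_isLb)
qed

text \<open>Both sequences decrease, so the bound at index \<open>max m n\<close> gives
  \<open>z \<le> a m + b n\<close> for independent \<open>m\<close> and \<open>n\<close>. With the
  indices separated, the two infima can be taken one after the other.\<close>

lemma decreases_to_zero_add_lower_bound:
  fixes z :: "'e::riesz_space"
  assumes a: "decreases_to_zero a" and b: "decreases_to_zero b"
    and z: "\<And>n. z \<le> a n + b n"
  shows "z \<le> 0"
proof -
  have dec: "decseq a" "decseq b"
    using a b by (simp_all add: decreases_to_zero_def)
  have "z - b n \<le> a m" for m n
  proof -
    have "z \<le> a (max m n) + b (max m n)"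
      by (rule z)
    also have "\<dots> \<le> a m + b n"
      using dec by (intro add_mono) (simp_all add: decseqD)
    finally show ?thesis
      by (simp add: diff_le_eq)
  qed
  \<comment> \<open>For fixed \<open>n\<close>, \<open>z - b n\<close> bounds all of
    \<open>a\<close> from below; once it is known to be at most 0, \<open>z\<close> bounds all of
    \<open>b\<close> from below.\<close>
  then have "z - b n \<le> 0" for n
    by (rule decreases_to_zero_lower_bound[OF a])
  then show ?thesis
    by (intro decreases_to_zero_lower_bound[OF b]) simp
qed

context vector_metric_space
begin

lemma dist_self: "x \<in> X \<Longrightarrow> d x x = 0"
  by (simp add: vm1)

text \<open>Taking the first argument as the intermediate point in \<open>vm2\<close> leaves
  \<open>d x y \<le> d y x\<close>, because \<open>d x x\<close> vanishes; exchanging the roles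
  gives the reverse inequality.\<close>

lemma dist_commute:
  assumes "x \<in> X" "y \<in> X"
  shows "d x y = d y x"
  using vm2[of x y x] vm2[of y x y] assms by (simp add: dist_self)

lemma dist_nonneg:
  assumes "x \<in> X" "y \<in> X"
  shows "0 \<le> d x y"
proof -
  \<comment> \<open>This is \<open>vm2\<close> for the pair \<open>x\<close>, \<open>x\<close> with
    intermediate point \<open>y\<close>. The order on the Riesz space may be partial, so the factor
    2 is removed by scaling with the positive real 1/2.\<close>
  have "0 \<le> d x y + d x y"
    using vm2[of x x y] assms by (simp add: dist_self)
  then have "0 \<le> (1 / 2) *\<^sub>R (d x y + d x y)"
    by (intro scaleR_nonneg_nonneg) simp_all
  then show ?thesis
    by (simp only: scaleR_half_double)
qed

lemma E_convergent_unique: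
  assumes "E_convergent X d s x" and "E_convergent X d s y"
  shows "x = y"
proof -
  obtain a b where a: "decreases_to_zero a" "\<And>n. d (s n) x \<le> a n"
    and b: "decreases_to_zero b" "\<And>n. d (s n) y \<le> b n"
    using assms by (auto simp: E_convergent_def)
  have X: "x \<in> X" "y \<in> X" "s n \<in> X" for n
    using assms by (auto simp: E_convergent_def)
  have "d x y \<le> a n + b n" for n
  proof -
    \<comment> \<open>Symmetry turns the distances from \<open>vm2\<close> into the orientation used
      by \<open>E_convergent\<close>.\<close>
    have "d x y \<le> d (s n) x + d (s n) y"
      using vm2[of x y "s n"] X by (simp add: dist_commute[of _ "s n"])
    also have "\<dots> \<le> a n + b n"
      by (intro add_mono a(2) b(2))
    finally show ?thesis .
  qed
  then have "d x y \<le> 0"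
    by (rule decreases_to_zero_add_lower_bound[OF a(1) b(1)])
  with dist_nonneg[OF X(1,2)] have "d x y = 0"
    by (rule antisym[rotated])
  then show ?thesis
    using X by (simp add: vm1)
qed

end

theorem theorem5:
  fixes X :: "'x set" and d :: "'x \<Rightarrow> 'x \<Rightarrow> 'e::riesz_space"
    and Y :: "'y set" and \<rho> :: "'y \<Rightarrow> 'y \<Rightarrow> 'f::riesz_space"
    and f g :: "'x \<Rightarrow> 'y"
  assumes "vector_metric_space X d"
    and "vector_metric_space Y \<rho>"
    and "vectorial_continuous X d Y \<rho> f"
    and "vectorial_continuous X d Y \<rho> g"
  shows "E_closed X d {x \<in> X. f x = g x}"
  unfolding E_closed_def
proof (intro conjI allI impI)
  show "{x \<in> X. f x = g x} \<subseteq> X"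
    by blast
next
  fix s x
  assume "range s \<subseteq> {x \<in> X. f x = g x} \<and> E_convergent X d s x"
  then have s: "(\<lambda>n. f (s n)) = (\<lambda>n. g (s n))" and conv: "E_convergent X d s x"
    by auto
  have x: "x \<in> X"
    using conv by (simp add: E_convergent_def)
  have "E_convergent Y \<rho> (\<lambda>n. f (s n)) (f x)" "E_convergent Y \<rho> (\<lambda>n. g (s n)) (g x)"
    using assms(3,4) x conv by (auto simp: vectorial_continuous_def)
  \<comment> \<open>Rewriting with \<open>s\<close> makes both convergence facts speak of the single
    sequence \<open>\<lambda>n. g (s n)\<close>, with limits \<open>f x\<close> and
    \<open>g x\<close>.\<close>
  then have "f x = g x"
    unfolding s by (rule vector_metric_space.E_convergent_unique[OF assms(2)])
  with x show "x \<in> {x \<in> X. f x = g x}"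
    by simp
qed

end
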